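(* Let $\mathbb{K}\in\{\mathbb{R},\mathbb{C}\}$, let $A,E\in\mathbb{K}^{m\times n}$, put $\widetilde{A}=A+E$, and let $k=\operatorname{rank}(A)$. Let $I\subset\{1,\dots,m\}$ and $J\subset\{1,\dots,n\}$, and put $C=A(:,J)$, $R=A(I,:)$, $U=A(I,J)$, $\widetilde{C}=\widetilde{A}(:,J)$, $\widetilde{R}=\widetilde{A}(I,:)$, $\widetilde{U}=\widetilde{A}(I,J)$. Assume $\operatorname{rank}(C)=\operatorname{rank}(U)=\operatorname{rank}(R)=k$. Let $A=W_k\Sigma_kV_k^*$ be a compact SVD of $A$, and let $W_{k,I}=W_k(I,:)$, $V_{k,J}=V_k(J,:)$. Let $\|\cdot\|$ be a normalized, uniformly generated, unitarily invariant, submultiplicative norm. Then \begin{align*} \|A-\widetilde{C}\widetilde{U}^\dagger\widetilde{R}\| \leq{}& \left(\|W_{k,I}^\dagger\|+\|V_{k,J}^\dagger\|+3\|W_{k,I}^\dagger\|\|V_{k,J}^\dagger\|\right)\|E\|\\ &+\|\widetilde{U}^\dagger\|\left(\|W_{k,I}^\dagger\|+\|V_{k,J}^\dagger\|+\|W_{k,I}^\dagger\|\|V_{k,J}^\dagger\|+1\right)\|E\|^2. \end{align*}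
   Context: For a matrix $B$ and index sets $I,J$, $B(I,J)$ is the submatrix with rows in $I$ and columns in $J$; $B(I,:)$ keeps all columns and $B(:,J)$ keeps all rows. $B^\dagger$ is the Moore--Penrose pseudoinverse. The compact SVD of a rank-$k$ matrix $A\in\mathbb{K}^{m\times n}$ is $A=W_k\Sigma_kV_k^*$ with $W_k\in\mathbb{K}^{m\times k}$, $V_k\in\mathbb{K}^{n\times k}$ having orthonormal columns and $\Sigma_k$ the $k\times k$ diagonal matrix of the positive singular values in descending order. A "normalized, uniformly generated, unitarily invariant, submultiplicative norm" is a family of norms $\|\cdot\|:\bigcup_{p,q\ge 1}\mathbb{K}^{p\times q}\to\mathbb{R}$ (a norm on each $\mathbb{K}^{p\times q}$) such that: $\|x\|=\|x\|_2$ (Euclidean norm) for every vector $x$ viewed as a matrix (normalized); there is a single symmetric function $\phi$ with $\|B\|=\phi(\sigma_1(B),\dots,\sigma_r(B))$, $r=\operatorname{rank}(B)$, for matrices $B$ of every size (uniformly generated); $\|\cdot\|$ is invariant under left and right multiplication by unitary matrices; and $\|BD\|\le\|B\|\|D\|$ whenever $BD$ is defined. All Schatten $p$-norms, $1\le p\le\infty$, are examples. *)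

theory Defs
  imports
    "HOL-Computational_Algebra.Polynomial"
    "Jordan_Normal_Form.Schur_Decomposition"
    "Jordan_Normal_Form.Char_Poly"
    "Jordan_Normal_Form.DL_Rank"
    "Jordan_Normal_Form.DL_Submatrix"
begin

(* The types of this class are exactly the isomorphic copies of the real and of the complex
   numbers, with conjugation and absolute value: h embeds the type into the complex numbers,
   and its image is the real line or the whole plane. *)
class real_or_complex = real_normed_field + conjugatable_field +
  assumes real_or_complex_embedding:
    "\<exists>h :: 'a \<Rightarrow> complex.
        inj h \<and> (range h = \<real> \<or> range h = UNIV) \<and>
        (\<forall>x y. h (x + y) = h x + h y) \<and>
        (\<forall>x y. h (x * y) = h x * h y) \<and>
        (\<forall>r x. h (scaleR r x) = scaleR r (h x)) \<and>
        (\<forall>x. h (conjugate x) = cnj (h x)) \<and>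
        (\<forall>x. cmod (h x) = norm x)"

instance real :: real_or_complex
proof
  show "\<exists>h :: real \<Rightarrow> complex.
        inj h \<and> (range h = \<real> \<or> range h = UNIV) \<and>
        (\<forall>x y. h (x + y) = h x + h y) \<and>
        (\<forall>x y. h (x * y) = h x * h y) \<and>
        (\<forall>r x. h (scaleR r x) = scaleR r (h x)) \<and>
        (\<forall>x. h (conjugate x) = cnj (h x)) \<and>
        (\<forall>x. cmod (h x) = norm x)"
    by (rule exI[of _ complex_of_real])
       (auto simp: inj_def Reals_def scaleR_conv_of_real)
qed

instance complex :: real_or_complex
proof
  show "\<exists>h :: complex \<Rightarrow> complex.
        inj h \<and> (range h = \<real> \<or> range h = UNIV) \<and>
        (\<forall>x y. h (x + y) = h x + h y) \<and>
        (\<forall>x y. h (x * y) = h x * h y) \<and>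
        (\<forall>r x. h (scaleR r x) = scaleR r (h x)) \<and>
        (\<forall>x. h (conjugate x) = cnj (h x)) \<and>
        (\<forall>x. cmod (h x) = norm x)"
    by (rule exI[of _ "\<lambda>x. x"]) auto
qed

abbreviation mat_rank :: "'a :: field mat \<Rightarrow> nat" where
  "mat_rank A \<equiv> vec_space.rank (dim_row A) A"

definition unitary_mat :: "'a :: real_or_complex mat \<Rightarrow> bool" where
  "unitary_mat Q \<longleftrightarrow> dim_row Q = dim_col Q
     \<and> mat_adjoint Q * Q = 1\<^sub>m (dim_col Q) \<and> Q * mat_adjoint Q = 1\<^sub>m (dim_row Q)"

definition orthonormal_cols :: "'a :: real_or_complex mat \<Rightarrow> bool" where
  "orthonormal_cols W \<longleftrightarrow> mat_adjoint W * W = 1\<^sub>m (dim_col W)"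

definition moore_penrose :: "'a :: real_or_complex mat \<Rightarrow> 'a mat \<Rightarrow> bool" where
  "moore_penrose B X \<longleftrightarrow> X \<in> carrier_mat (dim_col B) (dim_row B)
     \<and> B * X * B = B \<and> X * B * X = X
     \<and> mat_adjoint (B * X) = B * X \<and> mat_adjoint (X * B) = X * B"

definition pinv :: "'a :: real_or_complex mat \<Rightarrow> 'a mat" where
  "pinv B = (THE X. moore_penrose B X)"

(* The positive singular values in descending order, repeated according to multiplicity: the
   square roots of the nonzero eigenvalues of B^* B, counted as roots of its characteristic
   polynomial. These eigenvalues are nonnegative reals, so norm only changes their type. *)
definition singular_values :: "'a :: real_or_complex mat \<Rightarrow> real list" where
  "singular_values B = rev (sorted_list_of_multiset
     (image_mset (\<lambda>x. sqrt (norm x))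
       (filter_mset (\<lambda>x. x \<noteq> 0) (proots (char_poly (mat_adjoint B * B))))))"

definition compact_svd :: "'a :: real_or_complex mat \<Rightarrow> 'a mat \<Rightarrow> 'a mat \<Rightarrow> 'a mat \<Rightarrow> bool" where
  "compact_svd A W S V \<longleftrightarrow>
     W \<in> carrier_mat (dim_row A) (mat_rank A) \<and> orthonormal_cols W \<and>
     V \<in> carrier_mat (dim_col A) (mat_rank A) \<and> orthonormal_cols V \<and>
     S = mat_diag (mat_rank A) (\<lambda>i. of_real (singular_values A ! i)) \<and>
     A = W * S * mat_adjoint V"

(* The predicates below allow p = 0 and q = 0. This only gives a meaning to the norms that occur
   when A has rank 0 (W then has no columns): is_norm_family forces the norm of a matrix without
   entries to be 0. A family on the sizes p, q \<ge> 1 extends by 0 and keeps the other properties. *)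

definition is_norm_family :: "('a :: real_or_complex mat \<Rightarrow> real) \<Rightarrow> bool" where
  "is_norm_family N \<longleftrightarrow> (\<forall>p q.
     (\<forall>B \<in> carrier_mat p q. 0 \<le> N B \<and> (N B = 0 \<longleftrightarrow> B = 0\<^sub>m p q)) \<and>
     (\<forall>B \<in> carrier_mat p q. \<forall>c. N (c \<cdot>\<^sub>m B) = norm c * N B) \<and>
     (\<forall>B \<in> carrier_mat p q. \<forall>D \<in> carrier_mat p q. N (B + D) \<le> N B + N D))"

(* Vectors are viewed as matrices with one column. *)
definition normalized :: "('a :: real_or_complex mat \<Rightarrow> real) \<Rightarrow> bool" where
  "normalized N \<longleftrightarrow> (\<forall>p. \<forall>x \<in> carrier_mat p 1. N x = sqrt (\<Sum>i<p. (norm (x $$ (i, 0)))\<^sup>2))"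

definition uniformly_generated :: "('a :: real_or_complex mat \<Rightarrow> real) \<Rightarrow> bool" where
  "uniformly_generated N \<longleftrightarrow> (\<exists>\<phi> :: real list \<Rightarrow> real.
     (\<forall>xs ys. mset xs = mset ys \<longrightarrow> \<phi> xs = \<phi> ys) \<and>
     (\<forall>B. N B = \<phi> (singular_values B)))"

definition unitarily_invariant :: "('a :: real_or_complex mat \<Rightarrow> real) \<Rightarrow> bool" where
  "unitarily_invariant N \<longleftrightarrow> (\<forall>p q. \<forall>B \<in> carrier_mat p q.
     \<forall>P \<in> carrier_mat p p. \<forall>Q \<in> carrier_mat q q.
       unitary_mat P \<longrightarrow> unitary_mat Q \<longrightarrow> N (P * B * Q) = N B)"

definition submultiplicative :: "('a :: real_or_complex mat \<Rightarrow> real) \<Rightarrow> bool" where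
  "submultiplicative N \<longleftrightarrow> (\<forall>p q r. \<forall>B \<in> carrier_mat p q. \<forall>D \<in> carrier_mat q r.
     N (B * D) \<le> N B * N D)"

end

theory Submission
  imports Defs
begin

text \<open>
  The rank hypothesis on \<open>U = WI S VJ\<^sup>*\<close> forces \<open>WI\<close> and \<open>VJ\<close> to have full column rank, so their
  pseudoinverses are left inverses (\<open>pinv_mult_full_column_rank\<close>, \<open>pinv_mult_full_row_rank\<close>). Hence
  \<open>A = P U Q\<close>, \<open>C = P U\<close> and \<open>R = U Q\<close> with \<open>P = W (pinv WI)\<close> and \<open>Q = (V (pinv VJ))\<^sup>*\<close>. As \<open>W\<close> and \<open>V\<close> have
  orthonormal columns, \<open>P\<close> and \<open>Q\<close> have the norms of \<open>pinv WI\<close> and \<open>pinv VJ\<close>.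

  Let \<open>F\<close>, \<open>G\<close>, \<open>H\<close> be the blocks of \<open>E\<close> that are added to \<open>U\<close>, \<open>C\<close>, \<open>R\<close>, and let \<open>X\<close> be the pseudoinverse of
  \<open>U' = U + F\<close>. Substituting \<open>U = U' - F\<close> gives \<open>C' = P U' + G'\<close> and \<open>R' = U' Q + H'\<close> with \<open>G' = G - P F\<close> and
  \<open>H' = H - F Q\<close>, and since \<open>U' X U' = U'\<close>, expanding the product yields
  \<open>A - C' X R' = - (P F Q + P (U' X) H' + G' (X U') Q + G' X H')\<close>.
  The matrices \<open>U' X\<close> and \<open>X U'\<close> are orthogonal projections and do not increase the norm, so the four terms
  contribute \<open>p q e\<close>, \<open>p (1 + q) e\<close>, \<open>(1 + p) q e\<close> and \<open>(1 + p) (1 + q) x e\<^sup>2\<close>, where \<open>p\<close>, \<open>q\<close>, \<open>e\<close>, \<open>x\<close> are the norms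
  of \<open>P\<close>, \<open>Q\<close>, \<open>E\<close>, \<open>X\<close>. Their sum is the stated bound (\<open>cur_perturbation_bound\<close>).

  Three properties of the norm enter besides submultiplicativity. It does not change under
  multiplication by an isometry (\<open>norm_isometry_mult\<close>), since this preserves the Gram matrix, nor under
  passing to the adjoint (\<open>norm_adjoint\<close>), since the products \<open>B\<^sup>* B\<close> and \<open>B B\<^sup>*\<close> have the same nonzero
  eigenvalues. It does not increase under an orthogonal projection (\<open>norm_projection_mult\<close>), since that
  is the mean of the identity and a unitary reflection. Together they also bound the norms of the blocks of
  \<open>E\<close>, because selecting rows is multiplication by the adjoint of an isometry.
\<close>

section \<open>Adjoints and Gram matrices\<close>

text \<open>In this form the side conditions are equations between dimensions, which the simplifier can
  discharge; the inner dimensions that a carrier statement would leave to be guessed do not occur.\<close>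

lemma mult_assoc_dim:
  "dim_col A = dim_row B \<Longrightarrow> dim_col B = dim_row C \<Longrightarrow> (A * B) * C = A * (B * (C :: 'a :: semiring_0 mat))"
  by (rule assoc_mult_mat[of _ _ "dim_col A" _ "dim_col B"]) auto

lemma conjugate_one [simp]: "conjugate (1 :: 'a :: conjugatable_field) = 1"
  by (metis conjugate_dist_mul conjugate_zero_iff mult_cancel_left1 zero_neq_one mult_1)

lemma dim_mat_adjoint [simp]:
  "dim_row (mat_adjoint A) = dim_col A" "dim_col (mat_adjoint A) = dim_row A"
  unfolding mat_adjoint_def by auto

lemma mat_adjoint_carrier [intro, simp]: "A \<in> carrier_mat m n \<Longrightarrow> mat_adjoint A \<in> carrier_mat n m"
  by auto

lemma index_mat_adjoint [simp]:
  "i < dim_col A \<Longrightarrow> j < dim_row A \<Longrightarrow> mat_adjoint A $$ (i, j) = conjugate (A $$ (j, i))"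
  unfolding mat_adjoint_def by (simp add: mat_of_rows_def)

lemma mat_adjoint_adjoint [simp]: "mat_adjoint (mat_adjoint A) = A"
  by (rule eq_matI) auto

lemma mat_adjoint_one [simp]: "mat_adjoint (1\<^sub>m n) = 1\<^sub>m n"
  by (rule eq_matI) auto

lemma mat_adjoint_add:
  "dim_row A = dim_row B \<Longrightarrow> dim_col A = dim_col B \<Longrightarrow> mat_adjoint (A + B) = mat_adjoint A + mat_adjoint B"
  by (rule eq_matI) (auto simp: conjugate_dist_add)

lemma conjugate_diff: "conjugate (a - b) = conjugate a - conjugate (b :: 'a :: conjugatable_ring)"
  by (metis conjugate_dist_add conjugate_neg diff_conv_add_uminus)

lemma mat_adjoint_minus:
  "dim_row A = dim_row B \<Longrightarrow> dim_col A = dim_col B \<Longrightarrow> mat_adjoint (A - B) = mat_adjoint A - mat_adjoint B"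
  by (rule eq_matI) (auto simp: conjugate_diff)

lemma mat_adjoint_mult:
  "dim_col A = dim_row B \<Longrightarrow> mat_adjoint (A * B) = mat_adjoint B * mat_adjoint A"
  by (rule eq_matI) (auto simp: scalar_prod_def sum_conjugate conjugate_dist_mul mult.commute)

text \<open>Both sides have the same image under the embedding into the complex numbers, where this is
  the identity between \<open>z * cnj z\<close> and the square of the modulus.\<close>

lemma conjugate_mult_self:
  fixes x :: "'a :: real_or_complex"
  shows "conjugate x * x = of_real ((norm x)\<^sup>2)"
proof -
  obtain h :: "'a \<Rightarrow> complex" where h: "inj h"
      "\<And>x y. h (x * y) = h x * h y" "\<And>r x. h (scaleR r x) = scaleR r (h x)"
      "\<And>x. h (conjugate x) = cnj (h x)" "\<And>x. cmod (h x) = norm x"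
    using real_or_complex_embedding[where 'a = 'a] by metis
  have "h 1 \<noteq> 0"
    using h(5)[of 1] by auto
  then have h1: "h 1 = 1"
    using h(2)[of 1 1] by simp
  have "h (conjugate x * x) = of_real ((norm x)\<^sup>2)"
    using complex_norm_square[of "h x"] by (simp add: h mult.commute)
  moreover have "h (of_real ((norm x)\<^sup>2)) = of_real ((norm x)\<^sup>2)"
    unfolding of_real_def h(3) h1 ..
  ultimately have "h (conjugate x * x) = h (of_real ((norm x)\<^sup>2))"
    by simp
  then show ?thesis
    using h(1) by (simp add: inj_eq)
qed

text \<open>The diagonal entries of the Gram matrix are the squared Euclidean norms of the columns.\<close>

lemma gram_zero_imp_zero:
  fixes M :: "'a :: real_or_complex mat"
  assumes "mat_adjoint M * M = 0\<^sub>m (dim_col M) (dim_col M)"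
  shows "M = 0\<^sub>m (dim_row M) (dim_col M)"
proof (rule eq_matI)
  fix i j assume ij: "i < dim_row (0\<^sub>m (dim_row M) (dim_col M))" "j < dim_col (0\<^sub>m (dim_row M) (dim_col M))"
  have "0 = (mat_adjoint M * M) $$ (j, j)"
    using assms ij by simp
  also have "\<dots> = (\<Sum>i<dim_row M. conjugate (M $$ (i, j)) * M $$ (i, j))"
    using ij by (auto simp: scalar_prod_def atLeast0LessThan intro!: sum.cong)
  also have "\<dots> = of_real (\<Sum>i<dim_row M. (norm (M $$ (i, j)))\<^sup>2)"
    by (simp add: conjugate_mult_self)
  finally have "(\<Sum>i<dim_row M. (norm (M $$ (i, j)))\<^sup>2) = 0"
    by (metis of_real_eq_0_iff)
  then show "M $$ (i, j) = 0\<^sub>m (dim_row M) (dim_col M) $$ (i, j)"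
    using ij by (simp add: sum_nonneg_eq_0_iff)
qed auto

lemma minus_eq_zero_mat:
  fixes A :: "'a :: ring mat"
  assumes "A - B = 0\<^sub>m m n" "A \<in> carrier_mat m n" "B \<in> carrier_mat m n"
  shows "A = B"
proof (rule eq_matI)
  fix i j assume "i < dim_row B" "j < dim_col B"
  then have ij: "i < m" "j < n"
    using assms by auto
  have "(A - B) $$ (i, j) = 0"
    unfolding assms(1) using ij by simp
  then show "A $$ (i, j) = B $$ (i, j)"
    using ij assms(2,3) by simp
qed (use assms in auto)

text \<open>The difference \<open>M = B * (X - Y)\<close> has the Gram matrix \<open>(X - Y)\<^sup>* B\<^sup>* M\<close>, which vanishes by hypothesis.\<close>

lemma gram_mult_cancel:
  fixes B :: "'a :: real_or_complex mat"
  assumes B: "B \<in> carrier_mat p q" and X: "X \<in> carrier_mat q r" and Y: "Y \<in> carrier_mat q r"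
    and eq: "mat_adjoint B * B * X = mat_adjoint B * B * Y"
  shows "B * X = B * Y"
proof -
  define M where "M = B * (X - Y)"
  have M: "M \<in> carrier_mat p r" "M = B * X - B * Y"
    using B X Y by (auto simp: M_def mult_minus_distrib_mat)
  have "mat_adjoint B * M = mat_adjoint B * B * (X - Y)"
    using B X Y by (simp add: M_def mult_assoc_dim)
  also have "\<dots> = mat_adjoint B * B * X - mat_adjoint B * B * Y"
    using B X Y by (intro mult_minus_distrib_mat[where n=q]) auto
  finally have "mat_adjoint B * M = 0\<^sub>m q r"
    using eq B X Y by (auto intro!: eq_matI)
  moreover have "mat_adjoint M * M = mat_adjoint (X - Y) * (mat_adjoint B * M)"
    using B X Y by (simp add: M_def mat_adjoint_mult mult_assoc_dim)
  ultimately have "mat_adjoint M * M = 0\<^sub>m r r"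
    using X Y by auto
  then have "M = 0\<^sub>m p r"
    using gram_zero_imp_zero[of M] M(1) by simp
  then have "B * X - B * Y = 0\<^sub>m p r"
    using M(2) by simp
  then show ?thesis
    by (rule minus_eq_zero_mat) (use B X Y in auto)
qed

section \<open>Existence and uniqueness of the pseudoinverse\<close>

text \<open>For a matrix \<open>C\<close> in reduced row echelon form the witness \<open>Z\<close> sends the \<open>i\<close>-th unit vector to the unit
  vector of the pivot column of row \<open>i\<close>, and to zero if row \<open>i\<close> has no pivot. Then \<open>C * Z\<close> is diagonal with
  ones exactly at the nonzero rows of \<open>C\<close>, so that \<open>C * Z * C = C\<close>. In general one reduces \<open>B\<close> by an
  invertible \<open>P\<close> to such a matrix.\<close>

lemma generalized_inverse_exists:
  fixes B :: "'a :: field mat"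
  assumes B: "B \<in> carrier_mat p q"
  shows "\<exists>Y \<in> carrier_mat q p. B * Y * B = B"
proof -
  define C where "C = gauss_jordan_single B"
  have C: "C \<in> carrier_mat p q" and "row_echelon_form C"
    using gauss_jordan_single[OF B C_def[symmetric]] by auto
  obtain P Q where PQ: "C = P * B" "P \<in> carrier_mat p p" "Q \<in> carrier_mat p p" "Q * P = 1\<^sub>m p"
    using gauss_jordan_single(4)[OF B C_def[symmetric]] by auto
  obtain f where "pivot_fun C f q"
    using \<open>row_echelon_form C\<close> C unfolding row_echelon_form_def by auto
  note f = pivot_funD[OF carrier_matD(1)[OF C] this]
  define Z where "Z = mat q p (\<lambda>(j, i). if f i = j then 1 else (0 :: 'a))"
  have Z: "Z \<in> carrier_mat q p"
    by (simp add: Z_def)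
  have CZ: "(C * Z) $$ (i, i') = (if i = i' \<and> f i < q then 1 else 0)" if "i < p" "i' < p" for i i'
  proof -
    have "(C * Z) $$ (i, i') = (\<Sum>j<q. C $$ (i, j) * (if f i' = j then 1 else 0))"
      using that C by (simp add: Z_def scalar_prod_def atLeast0LessThan)
    also have "\<dots> = (\<Sum>j<q. if j = f i' then C $$ (i, j) else 0)"
      by (intro sum.cong) auto
    also have "\<dots> = (if f i' < q then C $$ (i, f i') else 0)"
      by simp
    finally show ?thesis
      using f(4)[of i'] f(5)[of i' i] that by auto
  qed
  have "C * Z * C = C"
  proof (rule eq_matI)
    fix i j assume ij: "i < dim_row C" "j < dim_col C"
    have "(D * C) $$ (i, j) = (\<Sum>l<p. D $$ (i, l) * C $$ (l, j))"
      if "D \<in> carrier_mat p p" for D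
      using ij C that by (simp add: scalar_prod_def atLeast0LessThan)
    from this[OF mult_carrier_mat[OF C Z]]
    have "(C * Z * C) $$ (i, j) = (\<Sum>l<p. (C * Z) $$ (i, l) * C $$ (l, j))" .
    also have "\<dots> = (\<Sum>l<p. if l = i then (if f i < q then C $$ (i, j) else 0) else 0)"
      using ij C by (intro sum.cong) (auto simp: CZ)
    also have "\<dots> = (if f i < q then C $$ (i, j) else 0)"
      using ij C by simp
    also have "\<dots> = C $$ (i, j)"
      using f(1)[of i] f(2)[of i j] ij C by auto
    finally show "(C * Z * C) $$ (i, j) = C $$ (i, j)" .
  qed (use C Z in auto)
  moreover have "Q * C = B"
    unfolding PQ(1) using PQ(2-4) B by (simp flip: assoc_mult_mat[OF PQ(3,2) B])
  moreover have "Q * (C * Z * (P * B)) = Q * C * (Z * P) * B"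
    using carrier_matD[OF B] carrier_matD[OF C] carrier_matD[OF Z] carrier_matD[OF PQ(2)] carrier_matD[OF PQ(3)]
    by (simp add: mult_assoc_dim)
  ultimately have "B * (Z * P) * B = B"
    unfolding PQ(1)[symmetric] by simp
  then show ?thesis
    using Z PQ(2) by (intro bexI[of _ "Z * P"]) auto
qed

text \<open>The Penrose equations determine \<open>B * X\<close> and \<open>X * B\<close>, as the orthogonal projections onto the range
  of \<open>B\<close> and onto the orthogonal complement of its kernel, and \<open>X = (X * B) * X = X * (B * X)\<close>.\<close>

lemma moore_penrose_unique:
  assumes X: "moore_penrose B X" and Y: "moore_penrose B Y"
  shows "X = Y"
proof -
  have dims: "dim_row X = dim_col B" "dim_col X = dim_row B" "dim_row Y = dim_col B" "dim_col Y = dim_row B"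
    using X Y by (auto simp: moore_penrose_def)
  have X': "B * X * B = B" "X * B * X = X" "mat_adjoint (B * X) = B * X" "mat_adjoint (X * B) = X * B"
    using X by (simp_all only: moore_penrose_def)
  have Y': "B * Y * B = B" "Y * B * Y = Y" "mat_adjoint (B * Y) = B * Y" "mat_adjoint (Y * B) = Y * B"
    using Y by (simp_all only: moore_penrose_def)
  have "B * X = B * Y * (B * X)"
    using Y'(1) dims by (metis mult_assoc_dim index_mult_mat(2,3))
  also have "\<dots> = mat_adjoint (B * X * (B * Y))"
    using X'(3) Y'(3) dims by (metis mat_adjoint_mult index_mult_mat(2,3))
  also have "B * X * (B * Y) = B * Y"
    using X'(1) dims by (metis mult_assoc_dim index_mult_mat(2,3))
  finally have BX: "B * X = B * Y"
    using Y'(3) by simp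
  have "X * B = X * B * (Y * B)"
    using Y'(1) dims by (metis mult_assoc_dim index_mult_mat(2,3))
  also have "\<dots> = mat_adjoint (Y * B * (X * B))"
    using X'(4) Y'(4) dims by (metis mat_adjoint_mult index_mult_mat(2,3))
  also have "Y * B * (X * B) = Y * B"
    using X'(1) dims by (metis mult_assoc_dim index_mult_mat(2,3))
  finally have XB: "X * B = Y * B"
    using Y'(4) by simp
  have "X = Y * B * X"
    using X'(2) XB by simp
  also have "\<dots> = Y * B * Y"
    using BX dims by (simp add: mult_assoc_dim)
  finally show ?thesis
    using Y'(2) by simp
qed

text \<open>If \<open>G\<close> is a generalized inverse of the Gram matrix of \<open>B\<close>, then \<open>X = G B\<^sup>*\<close> works: the factor
  \<open>B\<^sup>*\<close> can be cancelled from \<open>B\<^sup>* B G B\<^sup>* B = B\<^sup>* B\<close>, and then \<open>B G B\<^sup>*\<close> can be written as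
  \<open>B G (B\<^sup>* B) G\<^sup>* B\<^sup>*\<close>, which collapses to its adjoint.\<close>

lemma least_squares_inverse_exists:
  fixes B :: "'a :: real_or_complex mat"
  assumes B: "B \<in> carrier_mat p q"
  shows "\<exists>X \<in> carrier_mat q p. B * X * B = B \<and> mat_adjoint (B * X) = B * X"
proof -
  let ?H = "mat_adjoint B * B"
  have H: "?H \<in> carrier_mat q q"
    using B by auto
  obtain G where G: "G \<in> carrier_mat q q" "?H * G * ?H = ?H"
    using generalized_inverse_exists[OF H] by blast
  note dims = carrier_matD[OF B] carrier_matD[OF G(1)]
  have "?H * (G * ?H) = ?H * 1\<^sub>m q"
    unfolding right_mult_one_mat[OF H] using G(2) by (simp only: assoc_mult_mat[OF H G(1) H])
  then have "B * (G * ?H) = B * 1\<^sub>m q"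
    by (intro gram_mult_cancel[OF B]) (use B G(1) in auto)
  then have 1: "B * G * (mat_adjoint B * B) = B"
    using B dims by (simp add: mult_assoc_dim)
  have 2: "mat_adjoint B * B * (mat_adjoint G * mat_adjoint B) = mat_adjoint B"
    using arg_cong[OF 1, of mat_adjoint] dims by (simp add: mat_adjoint_mult mult_assoc_dim)
  have "B * (G * mat_adjoint B) = B * G * (mat_adjoint B * B * (mat_adjoint G * mat_adjoint B))"
    using dims by (simp add: 2 mult_assoc_dim)
  also have "\<dots> = B * G * (mat_adjoint B * B) * (mat_adjoint G * mat_adjoint B)"
    using dims by (simp add: mult_assoc_dim)
  also have "\<dots> = mat_adjoint (B * (G * mat_adjoint B))"
    unfolding 1 using dims by (simp add: mat_adjoint_mult mult_assoc_dim)
  finally have "mat_adjoint (B * (G * mat_adjoint B)) = B * (G * mat_adjoint B)" ..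
  moreover have "B * (G * mat_adjoint B) * B = B"
    using 1 dims by (simp add: mult_assoc_dim)
  ultimately show ?thesis
    using B G(1) by (intro bexI[of _ "G * mat_adjoint B"]) auto
qed

text \<open>The previous lemma for \<open>B\<close> gives \<open>X\<close> for which \<open>B * X\<close> is self-adjoint, and applied to the
  adjoint of \<open>B\<close> it gives \<open>Y\<close> for which \<open>Y * B\<close> is self-adjoint. The product \<open>Y * B * X\<close> inherits
  both properties, because multiplying it by \<open>B\<close> from the left gives \<open>B * X\<close> and from the right \<open>Y * B\<close>.\<close>

lemma moore_penrose_exists: "\<exists>X. moore_penrose B X"
proof -
  define p q where "p = dim_row B" and "q = dim_col B"
  have B: "B \<in> carrier_mat p q"
    by (auto simp: p_def q_def)
  obtain X where X: "X \<in> carrier_mat q p" "B * X * B = B" "mat_adjoint (B * X) = B * X"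
    using least_squares_inverse_exists[OF B] by blast
  obtain Z where Z: "Z \<in> carrier_mat p q" "mat_adjoint B * Z * mat_adjoint B = mat_adjoint B"
      "mat_adjoint (mat_adjoint B * Z) = mat_adjoint B * Z"
    using least_squares_inverse_exists[OF mat_adjoint_carrier[OF B]] by blast
  define Y where "Y = mat_adjoint Z"
  note dims = carrier_matD[OF B] carrier_matD[OF X(1)] carrier_matD[OF Z(1)]
  have Y: "Y \<in> carrier_mat q p"
    using Z(1) by (simp add: Y_def)
  note dims = dims carrier_matD[OF Y]
  have BYB: "B * Y * B = B"
    using arg_cong[OF Z(2), of mat_adjoint] dims by (simp add: Y_def mat_adjoint_mult mult_assoc_dim)
  have YB: "mat_adjoint (Y * B) = Y * B"
    using Z(3) dims by (simp add: Y_def mat_adjoint_mult)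
  have "B * (Y * B * X) = B * Y * B * X" "Y * B * X * B = Y * (B * X * B)"
    using dims by (simp_all add: mult_assoc_dim)
  then have left: "B * (Y * B * X) = B * X" and right: "Y * B * X * B = Y * B"
    unfolding BYB X(2) .
  have "Y * B * (Y * B * X) = Y * (B * Y * B) * X"
    using dims by (simp add: mult_assoc_dim)
  then have idem: "Y * B * X * B * (Y * B * X) = Y * B * X"
    unfolding right BYB .
  have "moore_penrose B (Y * B * X)"
    unfolding moore_penrose_def
  proof (intro conjI)
    show "B * (Y * B * X) * B = B"
      unfolding left by (rule X(2))
    show "mat_adjoint (B * (Y * B * X)) = B * (Y * B * X)"
      unfolding left by (rule X(3))
    show "mat_adjoint (Y * B * X * B) = Y * B * X * B"
      unfolding right by (rule YB)
  qed (use dims idem in \<open>simp_all only: carrier_mat_def mem_Collect_eq index_mult_mat\<close>)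
  then show ?thesis ..
qed

lemma moore_penrose_pinv: "moore_penrose B (pinv B)"
proof -
  obtain X where X: "moore_penrose B X"
    using moore_penrose_exists ..
  show ?thesis
    unfolding pinv_def
    by (rule theI[of "moore_penrose B", OF X]) (rule moore_penrose_unique[OF _ X])
qed

section \<open>Factors of full rank\<close>

text \<open>The column space of \<open>F * G\<close> lies in that of \<open>F\<close>, so \<open>F\<close> has rank \<open>k\<close> as well. As it has only
  \<open>k\<close> columns, they are distinct and linearly independent.\<close>

lemma mult_full_rank_cancel:
  fixes F G :: "'a :: field mat"
  assumes F: "F \<in> carrier_mat p k" and G: "G \<in> carrier_mat k q"
    and rank: "mat_rank (F * G) = k"
    and X: "X \<in> carrier_mat k r" and Y: "Y \<in> carrier_mat k r"
    and eq: "F * X = F * Y"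
  shows "X = Y"
proof -
  interpret vec_space "TYPE('a)" p .
  have "k \<le> rank F"
  proof -
    have FG: "F * G \<in> carrier_mat p q"
      using F G by auto
    have sub: "col_space (F * G) \<subseteq> col_space F"
    proof
      fix y assume "y \<in> col_space (F * G)"
      then obtain x where "x \<in> carrier_vec q" "y = F * G *\<^sub>v x" "y \<in> carrier_vec p"
        using F G unfolding col_space_eq[OF FG] by auto
      then show "y \<in> col_space F"
        using F G unfolding col_space_eq[OF F] by (auto intro!: bexI[of _ "G *\<^sub>v x"])
    qed
    have sF: "VectorSpace.subspace class_ring (span (set (cols F))) V"
      and sFG: "VectorSpace.subspace class_ring (span (set (cols (F * G)))) V"
      using cols_dim[of F] cols_dim[of "F * G"] F by (auto intro!: span_is_subspace)
    have "k = vectorspace.dim class_ring (span_vs (set (cols (F * G))))"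
      using rank F by (simp add: rank_def)
    also have "\<dots> \<le> vectorspace.dim class_ring (span_vs (set (cols F)))"
      using vectorspace.subspace_dim[OF subspace_is_vs[OF sF] nested_subspaces[OF sF sFG]]
        sub fin_dim_span_cols[OF F] fin_dim_span_cols[OF FG]
      unfolding col_space_def by simp
    finally show ?thesis
      by (simp add: rank_def)
  qed
  then have "rank F = k"
    using rank_le_nc[OF F] by simp
  obtain S where S: "maximal S (\<lambda>T. T \<subseteq> set (cols F) \<and> lin_indpt T)"
    using maximal_exists[of "(\<lambda>T. T \<subseteq> set (cols F) \<and> lin_indpt T)" "card (set (cols F))" "{}"]
    by (meson List.finite_set card_mono empty_iff empty_subsetI finite_lin_indpt2 rev_finite_subset)
  have "k \<le> card (set (cols F))"
    using rank_card_indpt[OF F S] S \<open>rank F = k\<close> card_mono[OF finite_set] by (auto simp: maximal_def)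
  then have cols: "card (set (cols F)) = length (cols F)"
    using card_length[of "cols F"] F by simp
  have "distinct (cols F)"
    using cols F by (simp add: card_distinct)
  then have indep: "lin_indpt (set (cols F))"
    using full_rank_lin_indpt[OF F \<open>rank F = k\<close>] by simp
  have inj: "v = 0\<^sub>v k" if "v \<in> carrier_vec k" "F *\<^sub>v v = 0\<^sub>v p" for v
    using lin_depI[OF F that(1) _ that(2) \<open>distinct (cols F)\<close>] indep by blast
  define D where "D = X - Y"
  have D: "D \<in> carrier_mat k r"
    using minus_carrier_mat[OF Y] by (simp add: D_def)
  have "F * D = F * X - F * Y"
    unfolding D_def by (rule mult_minus_distrib_mat[OF F X Y])
  also have "\<dots> = 0\<^sub>m p r"
    unfolding eq by (rule minus_r_inv_mat[OF mult_carrier_mat[OF F Y]])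
  finally have FD: "F * D = 0\<^sub>m p r" .
  have "D = 0\<^sub>m k r"
  proof (rule eq_matI)
    fix i j assume "i < dim_row (0\<^sub>m k r :: 'a mat)" "j < dim_col (0\<^sub>m k r :: 'a mat)"
    then have ij: "i < k" "j < r" by auto
    have "col D j = 0\<^sub>v k"
    proof (rule inj)
      show "col D j \<in> carrier_vec k"
        using D by (simp add: carrier_vecI)
      show "F *\<^sub>v col D j = 0\<^sub>v p"
        using col_mult2[OF F D ij(2)] FD ij by simp
    qed
    then have "col D j $ i = 0"
      using ij by simp
    then show "D $$ (i, j) = 0\<^sub>m k r $$ (i, j)"
      using ij D by simp
  qed (use D in auto)
  then show ?thesis
    unfolding D_def by (rule minus_eq_zero_mat[OF _ X Y])
qed

lemma pinv_carrier: "B \<in> carrier_mat p q \<Longrightarrow> pinv B \<in> carrier_mat q p"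
  using moore_penrose_pinv[of B] unfolding moore_penrose_def by (metis carrier_matD)

lemma mult_pinv_mult: "B * pinv B * B = B"
  using moore_penrose_pinv[of B] unfolding moore_penrose_def by (elim conjE)

lemma pinv_mult_full_column_rank:
  fixes F G :: "'a :: real_or_complex mat"
  assumes F: "F \<in> carrier_mat p k" and G: "G \<in> carrier_mat k q"
    and rank: "mat_rank (F * G) = k"
  shows "pinv F * F = 1\<^sub>m k"
proof (rule mult_full_rank_cancel[OF F G rank])
  note X = pinv_carrier[OF F]
  show "pinv F * F \<in> carrier_mat k k"
    using X F by auto
  show "F * (pinv F * F) = F * 1\<^sub>m k"
    using mult_pinv_mult[of F] right_mult_one_mat[OF F] assoc_mult_mat[OF F X F] by simp
qed auto

text \<open>Put \<open>G = V\<^sup>*\<close> and \<open>Y = (pinv V)\<^sup>*\<close>, so that \<open>G Y G = G\<close>. Then \<open>F G = (F G Y) G\<close>, and \<open>F G Y\<close> is left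
  cancellable by the rank condition. Cancelling it from \<open>(F G Y) (G Y) = F G Y\<close> gives \<open>G Y = 1\<close>. This
  avoids comparing the rank of a matrix with that of its adjoint.\<close>

lemma pinv_mult_full_row_rank:
  fixes F V :: "'a :: real_or_complex mat"
  assumes F: "F \<in> carrier_mat p k" and V: "V \<in> carrier_mat q k"
    and rank: "mat_rank (F * mat_adjoint V) = k"
  shows "pinv V * V = 1\<^sub>m k"
proof -
  define G where "G = mat_adjoint V"
  define Y where "Y = mat_adjoint (pinv V)"
  note X = pinv_carrier[OF V]
  have G: "G \<in> carrier_mat k q" and Y: "Y \<in> carrier_mat q k"
    using V X by (auto simp: G_def Y_def)
  note dims = carrier_matD[OF F] carrier_matD[OF V] carrier_matD[OF X] carrier_matD[OF G] carrier_matD[OF Y]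
  have GYG: "G * Y * G = G"
    using arg_cong[OF mult_pinv_mult[of V], of mat_adjoint] dims
    by (simp add: G_def Y_def mat_adjoint_mult mult_assoc_dim)
  have "F * (G * Y) * G = F * (G * Y * G)"
    using dims by (simp add: mult_assoc_dim)
  then have FG: "mat_rank (F * (G * Y) * G) = k"
    unfolding GYG using rank by (simp add: G_def)
  have "G * Y = 1\<^sub>m k"
  proof (rule mult_full_rank_cancel[OF _ G FG])
    have "F * (G * Y) * (G * Y) = F * (G * Y * G * Y)"
      using dims by (simp add: mult_assoc_dim)
    also have "\<dots> = F * (G * Y) * 1\<^sub>m k"
      unfolding GYG using F G Y by simp
    finally show "F * (G * Y) * (G * Y) = F * (G * Y) * 1\<^sub>m k" .
  qed (use F G Y in auto)
  then have "mat_adjoint (G * Y) = 1\<^sub>m k"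
    by simp
  then show ?thesis
    using dims by (simp add: mat_adjoint_mult) (simp add: G_def Y_def)
qed

section \<open>Singular values\<close>

text \<open>Sylvester's identity. Multiplying the block matrix \<open>M\<close> with rows \<open>(x, A)\<close> and \<open>(B, 1)\<close> by two block
  triangular matrices of the same determinant \<open>x ^ q\<close> makes it upper triangular with diagonal blocks
  \<open>x - A * B\<close> and \<open>x\<close>, respectively lower triangular with diagonal blocks \<open>x\<close> and \<open>x - B * A\<close>.\<close>

lemma char_poly_mult_commute:
  fixes A B :: "'a :: field mat"
  assumes A: "A \<in> carrier_mat p q" and B: "B \<in> carrier_mat q p"
  shows "[:0, 1:] ^ q * char_poly (A * B) = [:0, 1:] ^ p * char_poly (B * A)"
proof -
  define c where "c = (\<lambda>M :: 'a mat. map_mat (\<lambda>a. [:a:]) M)"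
  define x where "x = [:0, 1 :: 'a:]"
  have const_sum: "(\<Sum>i\<in>S. [:f i:]) = [:\<Sum>i\<in>S. f i :: 'a:]" for f and S :: "nat set"
    by (induction S rule: infinite_finite_induct) auto
  have char_poly: "char_poly (F * G) = det (x \<cdot>\<^sub>m 1\<^sub>m m - c F * c G)"
    if "F \<in> carrier_mat m n" "G \<in> carrier_mat n m" for F G m n
  proof -
    have "char_poly_matrix (F * G) = x \<cdot>\<^sub>m 1\<^sub>m m - c F * c G"
      using that
      by (intro eq_matI) (auto simp: char_poly_matrix_def x_def c_def scalar_prod_def const_sum mult.commute)
    then show ?thesis
      by (simp add: char_poly_def)
  qed
  have a: "c A \<in> carrier_mat p q" and b: "c B \<in> carrier_mat q p"
    using A B by (auto simp: c_def)
  have one: "1\<^sub>m n \<in> carrier_mat n n" "x \<cdot>\<^sub>m 1\<^sub>m n \<in> carrier_mat n n" for n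
    by auto
  have det_x: "det (x \<cdot>\<^sub>m 1\<^sub>m n) = x ^ n" for n
    by (simp add: det_smult)
  let ?M = "four_block_mat (x \<cdot>\<^sub>m 1\<^sub>m p) (c A) (c B) (1\<^sub>m q)"
  let ?K = "four_block_mat (1\<^sub>m p) (0\<^sub>m p q) (- c B) (x \<cdot>\<^sub>m 1\<^sub>m q)"
  let ?L = "four_block_mat (1\<^sub>m p) (- c A) (0\<^sub>m q p) (x \<cdot>\<^sub>m 1\<^sub>m q)"
  have M: "?M \<in> carrier_mat (p + q) (p + q)" and K: "?K \<in> carrier_mat (p + q) (p + q)"
    and L: "?L \<in> carrier_mat (p + q) (p + q)"
    by (intro four_block_carrier_mat one)+
  have detK: "det ?K = x ^ q" and detL: "det ?L = x ^ q"
    using a b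
    by (simp_all add: det_four_block_mat_upper_right_zero[OF one(1) refl _ one(2)]
        det_four_block_mat_lower_left_zero[OF one(1) _ refl one(2)] det_x)
  have cancel: "- (x \<cdot>\<^sub>m 1\<^sub>m p * c A) + c A * (x \<cdot>\<^sub>m 1\<^sub>m q) = 0\<^sub>m p q"
    using a by (simp add: mult_smult_assoc_mat[OF one(1)] mult_smult_distrib[OF _ one(1)])
  have flip: "- D + x \<cdot>\<^sub>m 1\<^sub>m q = x \<cdot>\<^sub>m 1\<^sub>m q - D" if "D \<in> carrier_mat q q" for D
    using that by (intro eq_matI) auto
  have "?M * ?K = four_block_mat (x \<cdot>\<^sub>m 1\<^sub>m p - c A * c B) (c A * (x \<cdot>\<^sub>m 1\<^sub>m q)) (0\<^sub>m q p) (x \<cdot>\<^sub>m 1\<^sub>m q)"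
    by (subst mult_four_block_mat[OF one(2) a b one(1) one(1) _ _ one(2)])
       (use a b in auto)
  then have "det (?M * ?K) = char_poly (A * B) * x ^ q"
    using a b minus_carrier_mat[OF mult_carrier_mat[OF a b]]
    by (simp add: det_four_block_mat_lower_left_zero[OF _ _ refl one(2)] char_poly[OF A B] det_x)
  moreover have "?M * ?L = four_block_mat (x \<cdot>\<^sub>m 1\<^sub>m p) (0\<^sub>m p q) (c B) (x \<cdot>\<^sub>m 1\<^sub>m q - c B * c A)"
    by (subst mult_four_block_mat[OF one(2) a b one(1) one(1) _ _ one(2)])
       (use a b cancel flip[OF mult_carrier_mat[OF b a]] in auto)
  then have "det (?M * ?L) = x ^ p * char_poly (B * A)"
    using a b minus_carrier_mat[OF mult_carrier_mat[OF b a]]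
    by (simp add: det_four_block_mat_upper_right_zero[OF one(2) refl] char_poly[OF B A] det_x)
  moreover have "det (?M * ?K) = det (?M * ?L)"
    unfolding det_mult[OF M K] det_mult[OF M L] detK detL ..
  ultimately show ?thesis
    by (simp add: x_def mult.commute)
qed

text \<open>The powers of the variable in Sylvester's identity only contribute roots that are zero.\<close>

lemma nonzero_proots_char_poly_mult_commute:
  fixes A B :: "'a :: field mat"
  assumes A: "A \<in> carrier_mat p q" and B: "B \<in> carrier_mat q p"
  shows "filter_mset (\<lambda>x. x \<noteq> 0) (proots (char_poly (A * B)))
    = filter_mset (\<lambda>x. x \<noteq> 0) (proots (char_poly (B * A)))"
proof -
  have *: "filter_mset (\<lambda>x. x \<noteq> 0) (proots ([:0, 1:] ^ n * f)) = filter_mset (\<lambda>x. x \<noteq> 0) (proots f)"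
    if "f \<noteq> 0" for f :: "'a poly" and n
    using that by (subst proots_mult) (simp_all add: proots_power multiset_eq_iff)
  have "char_poly (A * B) \<noteq> 0" "char_poly (B * A) \<noteq> 0"
    using degree_monic_char_poly[OF mult_carrier_mat[OF A B]]
      degree_monic_char_poly[OF mult_carrier_mat[OF B A]] by auto
  then show ?thesis
    using char_poly_mult_commute[OF A B] * by metis
qed

text \<open>This is where the two characteristic polynomials have to be compared: the Gram matrices of
  \<open>B\<close> and of its adjoint are the two products of the same pair of matrices.\<close>

lemma singular_values_adjoint: "singular_values (mat_adjoint B) = singular_values B"
  unfolding singular_values_def
  by (simp add: nonzero_proots_char_poly_mult_commute[of B "dim_row B" "dim_col B"])

lemma singular_values_isometry_mult:
  assumes "orthonormal_cols T" and "dim_col T = dim_row B"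
  shows "singular_values (T * B) = singular_values B"
proof -
  have "mat_adjoint (T * B) * (T * B) = mat_adjoint B * (mat_adjoint T * T) * B"
    using assms(2) by (simp add: mat_adjoint_mult mult_assoc_dim)
  also have "\<dots> = mat_adjoint B * B"
    using assms by (simp add: orthonormal_cols_def)
  finally show ?thesis
    by (simp add: singular_values_def)
qed

section \<open>Unitarily invariant norms\<close>

lemma norm_eqI:
  assumes "uniformly_generated N" "singular_values B = singular_values D"
  shows "N B = N D"
  using assms by (metis uniformly_generated_def)

lemma norm_adjoint: "uniformly_generated N \<Longrightarrow> N (mat_adjoint B) = N B"
  by (rule norm_eqI[OF _ singular_values_adjoint])

text \<open>Submultiplicativity would not suffice here, because the norm of an isometry can exceed one:
  the Frobenius norm of \<open>T\<close> is the square root of its number of columns.\<close>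

lemma norm_isometry_mult:
  "uniformly_generated N \<Longrightarrow> orthonormal_cols T \<Longrightarrow> dim_col T = dim_row B \<Longrightarrow> N (T * B) = N B"
  by (rule norm_eqI[OF _ singular_values_isometry_mult])

lemma norm_family_nonneg:
  "is_norm_family N \<Longrightarrow> 0 \<le> N B"
  unfolding is_norm_family_def by (metis carrier_mat_triv)

lemma norm_family_add:
  "is_norm_family N \<Longrightarrow> B \<in> carrier_mat p q \<Longrightarrow> D \<in> carrier_mat p q \<Longrightarrow> N (B + D) \<le> N B + N D"
  unfolding is_norm_family_def by blast

lemma norm_family_smult:
  "is_norm_family N \<Longrightarrow> N (c \<cdot>\<^sub>m B) = norm c * N B"
  unfolding is_norm_family_def by (metis carrier_mat_triv)

lemma norm_family_diff:
  assumes "is_norm_family N" "B \<in> carrier_mat p q" "D \<in> carrier_mat p q"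
  shows "N (B - D) \<le> N B + N D"
proof -
  have "B - D = B + (- 1) \<cdot>\<^sub>m D"
    using assms by (intro eq_matI) auto
  then show ?thesis
    using norm_family_add[OF assms(1,2), of "(- 1) \<cdot>\<^sub>m D"] norm_family_smult[OF assms(1), of "- 1" D] assms(3)
    by simp
qed

lemma norm_mult:
  "submultiplicative N \<Longrightarrow> dim_col B = dim_row D \<Longrightarrow> N (B * D) \<le> N B * N D"
  unfolding submultiplicative_def by (metis carrier_mat_triv)

text \<open>The reflection fixes the range of the projection and negates its orthogonal complement.\<close>

lemma unitary_reflection:
  fixes P :: "'a :: real_or_complex mat"
  assumes P: "P \<in> carrier_mat p p" and idem: "P * P = P" and adj: "mat_adjoint P = P"
  shows "unitary_mat (P + P - 1\<^sub>m p)"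
proof -
  let ?Q = "P + P - 1\<^sub>m p"
  have Q: "?Q \<in> carrier_mat p p"
    using P by auto
  have "?Q * ?Q = (P + P) * ?Q - ?Q"
    using P Q by (simp add: minus_mult_distrib_mat[of _ p p] del: minus_carrier_mat)
  also have "(P + P) * ?Q = P * ?Q + P * ?Q"
    using P Q by (intro add_mult_distrib_mat) auto
  also have "P * ?Q = P * (P + P) - P * 1\<^sub>m p"
    using P by (intro mult_minus_distrib_mat) auto
  also have "P * (P + P) = P + P"
    using P idem by (simp add: mult_add_distrib_mat[of _ p p])
  finally have "?Q * ?Q = 1\<^sub>m p"
    using P by (auto intro!: eq_matI)
  moreover have "mat_adjoint ?Q = ?Q"
    using P adj by (simp add: mat_adjoint_minus mat_adjoint_add)
  ultimately show ?thesis
    using P by (simp add: unitary_mat_def)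
qed

text \<open>The product \<open>P * B\<close> is the mean of \<open>B\<close> and its image under the reflection \<open>2 P - 1\<close>, and unitary
  invariance gives both of them the same norm. As for isometries, submultiplicativity alone is too weak.\<close>

lemma norm_projection_mult:
  assumes N: "is_norm_family N" "unitarily_invariant N"
    and P: "P \<in> carrier_mat p p" "P * P = P" "mat_adjoint P = P"
    and B: "B \<in> carrier_mat p q"
  shows "N (P * B) \<le> N B"
proof -
  let ?Q = "P + P - 1\<^sub>m p"
  have Q: "?Q \<in> carrier_mat p p"
    using P by auto
  have "unitary_mat (1\<^sub>m q)"
    by (simp add: unitary_mat_def)
  then have "N (?Q * B * 1\<^sub>m q) = N B"
    by (rule N(2)[unfolded unitarily_invariant_def, rule_format, OF B Q one_carrier_mat unitary_reflection[OF P]])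
  then have inv: "N (?Q * B) = N B"
    using right_mult_one_mat[OF mult_carrier_mat[OF Q B]] by simp
  have "?Q * B = P * B + P * B - B"
    using P(1) B by (simp add: minus_mult_distrib_mat[of _ p p] add_mult_distrib_mat[of _ p p])
  then have double: "2 \<cdot>\<^sub>m (P * B) = ?Q * B + B"
    using P(1) B by (auto intro!: eq_matI)
  have "2 * N (P * B) = N (2 \<cdot>\<^sub>m (P * B))"
    unfolding norm_family_smult[OF N(1)] by simp
  also have "\<dots> \<le> N (?Q * B) + N B"
    unfolding double by (rule norm_family_add[OF N(1) mult_carrier_mat[OF Q B] B])
  finally show ?thesis
    unfolding inv by simp
qed

text \<open>Multiplication by the isometry \<open>T\<close> preserves the norm and turns \<open>T\<^sup>* B\<close> into the orthogonal projection
  of \<open>B\<close> to the range of \<open>T\<close>.\<close>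

lemma norm_coisometry_mult:
  assumes N: "is_norm_family N" "uniformly_generated N" "unitarily_invariant N"
    and T: "T \<in> carrier_mat p r" "orthonormal_cols T" and B: "B \<in> carrier_mat p q"
  shows "N (mat_adjoint T * B) \<le> N B"
proof -
  note dims = carrier_matD[OF T(1)] carrier_matD[OF B]
  have TT: "mat_adjoint T * T = 1\<^sub>m r"
    using T by (simp add: orthonormal_cols_def)
  have "N (mat_adjoint T * B) = N (T * (mat_adjoint T * B))"
    using dims by (simp add: norm_isometry_mult[OF N(2) T(2)])
  also have "T * (mat_adjoint T * B) = T * mat_adjoint T * B"
    using dims by (simp add: mult_assoc_dim)
  also have "N \<dots> \<le> N B"
  proof (rule norm_projection_mult[OF N(1,3) _ _ _ B])
    have "T * mat_adjoint T * (T * mat_adjoint T) = T * (mat_adjoint T * T) * mat_adjoint T"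
      using dims by (simp add: mult_assoc_dim)
    then show "T * mat_adjoint T * (T * mat_adjoint T) = T * mat_adjoint T"
      using T(1) by (simp add: TT)
  qed (use dims in \<open>auto simp: mat_adjoint_mult\<close>)
  finally show ?thesis .
qed

section \<open>Submatrices as products\<close>

text \<open>The columns are the unit vectors with index in \<open>J\<close>, in increasing order; multiplication by this
  matrix and its adjoint expresses passing to submatrices.\<close>

definition selection_mat :: "nat \<Rightarrow> nat set \<Rightarrow> 'a :: {zero, one} mat" where
  "selection_mat n J = mat n (card {j. j < n \<and> j \<in> J}) (\<lambda>(i, j). if i = pick J j then 1 else 0)"

lemma selection_mat_carrier: "selection_mat n J \<in> carrier_mat n (card {j. j < n \<and> j \<in> J})"
  by (simp add: selection_mat_def)

lemma mult_selection_mat: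
  fixes A :: "'a :: semiring_1 mat"
  assumes A: "A \<in> carrier_mat m n"
  shows "A * selection_mat n J = submatrix A UNIV J"
proof (rule eq_matI)
  fix i j assume "i < dim_row (submatrix A UNIV J)" "j < dim_col (submatrix A UNIV J)"
  then have ij: "i < m" "j < card {j. j < n \<and> j \<in> J}"
    using A by (auto simp: dim_submatrix)
  then have "pick J j < n"
    using pick_le by blast
  have "(A * selection_mat n J) $$ (i, j) = (\<Sum>l<n. A $$ (i, l) * (if l = pick J j then 1 else 0))"
    using A ij by (simp add: selection_mat_def scalar_prod_def atLeast0LessThan)
  also have "\<dots> = (\<Sum>l<n. if l = pick J j then A $$ (i, l) else 0)"
    by (intro sum.cong) auto
  also have "\<dots> = submatrix A UNIV J $$ (i, j)"
    using A ij \<open>pick J j < n\<close> by (simp add: submatrix_index pick_UNIV)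
  finally show "(A * selection_mat n J) $$ (i, j) = submatrix A UNIV J $$ (i, j)" .
qed (use A in \<open>auto simp: selection_mat_def dim_submatrix\<close>)

lemma adjoint_selection_mat_mult:
  fixes A :: "'a :: conjugatable_field mat"
  assumes A: "A \<in> carrier_mat m n"
  shows "mat_adjoint (selection_mat m I) * A = submatrix A I UNIV"
proof (rule eq_matI)
  fix i j assume "i < dim_row (submatrix A I UNIV)" "j < dim_col (submatrix A I UNIV)"
  then have ij: "j < n" "i < card {i. i < m \<and> i \<in> I}"
    using A by (auto simp: dim_submatrix)
  then have "pick I i < m"
    using pick_le by blast
  have "(mat_adjoint (selection_mat m I) * A) $$ (i, j)
      = (\<Sum>l<m. conjugate (if l = pick I i then 1 else 0) * A $$ (l, j))"
    using A ij by (simp add: selection_mat_def scalar_prod_def atLeast0LessThan)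
  also have "\<dots> = (\<Sum>l<m. if l = pick I i then A $$ (l, j) else 0)"
    by (intro sum.cong) auto
  also have "\<dots> = submatrix A I UNIV $$ (i, j)"
    using A ij \<open>pick I i < m\<close> by (simp add: submatrix_index pick_UNIV)
  finally show "(mat_adjoint (selection_mat m I) * A) $$ (i, j) = submatrix A I UNIV $$ (i, j)" .
qed (use A in \<open>auto simp: selection_mat_def dim_submatrix\<close>)

text \<open>The index \<open>i\<close> is recovered from \<open>pick J i\<close> as the number of smaller elements of \<open>J\<close>.\<close>

lemma inj_on_pick: "inj_on (pick J) {..<card {j. j < n \<and> j \<in> J}}"
proof (rule inj_on_inverseI)
  let ?S = "{j. j < n \<and> j \<in> J}"
  fix i assume i: "i \<in> {..<card ?S}"
  then have "pick J i = pick ?S i"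
    by (intro pick_reduce_set) simp
  then show "card {a \<in> ?S. a < pick J i} = i"
    using card_pick_le[of i ?S] i by simp
qed

lemma orthonormal_cols_selection_mat:
  "orthonormal_cols (selection_mat n J :: 'a :: real_or_complex mat)"
proof -
  let ?T = "selection_mat n J :: 'a mat" and ?c = "card {j. j < n \<and> j \<in> J}"
  have "mat_adjoint ?T * ?T = 1\<^sub>m ?c"
  proof (rule eq_matI)
    fix i j assume "i < dim_row (1\<^sub>m ?c :: 'a mat)" "j < dim_col (1\<^sub>m ?c :: 'a mat)"
    then have ij: "i < ?c" "j < ?c" by auto
    then have "pick J i < n"
      using pick_le by blast
    have "(mat_adjoint ?T * ?T) $$ (i, j)
        = (\<Sum>l<n. conjugate (if l = pick J i then 1 else 0) * (if l = pick J j then 1 else 0))"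
      using ij by (simp add: selection_mat_def scalar_prod_def atLeast0LessThan)
    also have "\<dots> = (\<Sum>l<n. if l = pick J i then if pick J i = pick J j then 1 else 0 else 0)"
      by (intro sum.cong) auto
    also have "\<dots> = 1\<^sub>m ?c $$ (i, j)"
      using ij \<open>pick J i < n\<close> inj_onD[OF inj_on_pick[of J n], of i j] by auto
    finally show "(mat_adjoint ?T * ?T) $$ (i, j) = 1\<^sub>m ?c $$ (i, j)" .
  qed (auto simp: selection_mat_def)
  then show ?thesis
    by (simp add: orthonormal_cols_def selection_mat_def)
qed

section \<open>Perturbation of the CUR decomposition\<close>

text \<open>With \<open>U' = U + F\<close>, \<open>G' = G - P F\<close> and \<open>H' = H - F Q\<close> the perturbed factors are \<open>P U' + G'\<close> and
  \<open>U' Q + H'\<close>. In the product of these two around \<open>X\<close> the leading term is \<open>P U' X U' Q = P U' Q\<close>, so it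
  differs from \<open>P U Q\<close> by \<open>P F Q\<close>; the two mixed terms contain the orthogonal projections \<open>U' X\<close> and
  \<open>X U'\<close> in place of \<open>X\<close>. Only \<open>G' X H'\<close> retains a factor \<open>X\<close>, and it is quadratic in the perturbation.\<close>

lemma cur_perturbation_bound:
  fixes P Q U F G H X :: "'a :: real_or_complex mat"
  assumes N: "is_norm_family N" "unitarily_invariant N" "submultiplicative N"
    and P: "P \<in> carrier_mat m a" and Q: "Q \<in> carrier_mat b n" and U: "U \<in> carrier_mat a b"
    and F: "F \<in> carrier_mat a b" and G: "G \<in> carrier_mat m b" and H: "H \<in> carrier_mat a n"
    and X: "moore_penrose (U + F) X"
    and e: "N F \<le> e" "N G \<le> e" "N H \<le> e"
  shows "N (P * U * Q - (P * U + G) * X * (U * Q + H))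
    \<le> (N P + N Q + 3 * N P * N Q) * e + N X * (N P + N Q + N P * N Q + 1) * e\<^sup>2"
proof -
  define U' where "U' = U + F"
  define G' where "G' = G - P * F"
  define H' where "H' = H - F * Q"
  have U': "U' \<in> carrier_mat a b"
    using U F by (simp add: U'_def)
  have "moore_penrose U' X"
    unfolding U'_def by (rule X)
  then have Xc: "X \<in> carrier_mat b a" and X1: "U' * X * U' = U'" and X2: "X * U' * X = X"
    and X3: "mat_adjoint (U' * X) = U' * X" and X4: "mat_adjoint (X * U') = X * U'"
    by (simp_all only: moore_penrose_def carrier_matD[OF U'])
  have G': "G' \<in> carrier_mat m b" and H': "H' \<in> carrier_mat a n"
    using minus_carrier_mat[OF mult_carrier_mat[OF P F]] minus_carrier_mat[OF mult_carrier_mat[OF F Q]]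
    by (simp_all add: G'_def H'_def)
  note dims = carrier_matD[OF P] carrier_matD[OF Q] carrier_matD[OF U] carrier_matD[OF F]
    carrier_matD[OF U'] carrier_matD[OF Xc] carrier_matD[OF G'] carrier_matD[OF H']
  define T1 where "T1 = P * (F * Q)"
  define T2 where "T2 = P * (U' * X * H')"
  define T3 where "T3 = G' * (X * U' * Q)"
  define T4 where "T4 = G' * (X * H')"
  note T_defs = T1_def T2_def T3_def T4_def
  have T: "T1 \<in> carrier_mat m n" "T2 \<in> carrier_mat m n" "T3 \<in> carrier_mat m n" "T4 \<in> carrier_mat m n"
    unfolding T_defs by (intro carrier_matI; simp add: dims)+
  have PUQ: "P * U * Q \<in> carrier_mat m n"
    using P U Q by simp
  have C: "P * U + G = P * U' + G'"
  proof -
    have "P * U' = P * U + P * F"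
      unfolding U'_def by (rule mult_add_distrib_mat[OF P U F])
    then show ?thesis
      unfolding G'_def using P U F G by (auto intro!: eq_matI)
  qed
  have R: "U * Q + H = U' * Q + H'"
  proof -
    have "U' * Q = U * Q + F * Q"
      unfolding U'_def by (rule add_mult_distrib_mat[OF U F Q])
    then show ?thesis
      unfolding H'_def using Q U F H by (auto intro!: eq_matI)
  qed
  have expand: "(P * U + G) * X * (U * Q + H) = (P * U * Q + T1) + (T2 + (T3 + T4))"
  proof -
    let ?L = "P * U' * X" and ?M = "G' * X"
    have L: "?L \<in> carrier_mat m a" and M: "?M \<in> carrier_mat m a" and UQ: "U' * Q \<in> carrier_mat a n"
      using P U' G' Xc Q by auto
    have 1: "?L * (U' * Q) = P * U * Q + T1"
    proof -
      have "?L * (U' * Q) = P * ((U' * X * U') * Q)"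
        using dims by (simp add: mult_assoc_dim)
      also have "\<dots> = P * (U * Q + F * Q)"
        unfolding X1 unfolding U'_def unfolding add_mult_distrib_mat[OF U F Q] ..
      also have "\<dots> = P * (U * Q) + P * (F * Q)"
        by (rule mult_add_distrib_mat[OF P mult_carrier_mat[OF U Q] mult_carrier_mat[OF F Q]])
      finally show ?thesis
        unfolding T1_def assoc_mult_mat[OF P U Q] .
    qed
    have 2: "?L * H' = T2" "?M * (U' * Q) = T3" "?M * H' = T4"
      unfolding T_defs using dims by (simp_all add: mult_assoc_dim)
    have "(P * U + G) * X * (U * Q + H) = (?L + ?M) * (U' * Q + H')"
      unfolding C R add_mult_distrib_mat[OF mult_carrier_mat[OF P U'] G' Xc] ..
    also have "\<dots> = ?L * (U' * Q + H') + ?M * (U' * Q + H')"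
      by (rule add_mult_distrib_mat[OF L M add_carrier_mat[OF H']])
    also have "\<dots> = (P * U * Q + T1) + T2 + (T3 + T4)"
      unfolding mult_add_distrib_mat[OF L UQ H'] mult_add_distrib_mat[OF M UQ H'] 1 2 ..
    also have "\<dots> = (P * U * Q + T1) + (T2 + (T3 + T4))"
      by (rule assoc_add_mat[OF add_carrier_mat[OF T(1)] T(2) add_carrier_mat[OF T(4)]])
    finally show ?thesis .
  qed
  have "P * U * Q - (P * U + G) * X * (U * Q + H) = (- 1) \<cdot>\<^sub>m (T1 + (T2 + (T3 + T4)))"
    unfolding expand using T PUQ by (intro eq_matI) auto
  then have "N (P * U * Q - (P * U + G) * X * (U * Q + H)) = N (T1 + (T2 + (T3 + T4)))"
    by (simp add: norm_family_smult[OF N(1)])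
  also have "\<dots> \<le> N T1 + (N T2 + (N T3 + N T4))"
    using norm_family_add[OF N(1) T(1) add_carrier_mat[OF add_carrier_mat[OF T(4)]], of T2 T3]
      norm_family_add[OF N(1) T(2) add_carrier_mat[OF T(4)], of T3] norm_family_add[OF N(1) T(3,4)]
    by linarith
  also have "\<dots> \<le> N P * (e * N Q) + (N P * (e + e * N Q)
      + ((e + N P * e) * N Q + (e + N P * e) * (N X * (e + e * N Q))))"
  proof -
    note nonneg = norm_family_nonneg[OF N(1)]
    have mult: "N (B * D) \<le> \<beta> * \<delta>" if "dim_col B = dim_row D" "N B \<le> \<beta>" "N D \<le> \<delta>" for B D \<beta> \<delta>
      using norm_mult[OF N(3) that(1)] mult_mono[OF that(2,3)] nonneg[of B] nonneg[of D] that(2)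
      by linarith
    have FQ: "N (F * Q) \<le> e * N Q"
      by (rule mult[OF _ e(1) order_refl]) (simp add: dims)
    have PF: "N (P * F) \<le> N P * e"
      by (rule mult[OF _ order_refl e(1)]) (simp add: dims)
    have NG: "N G' \<le> e + N P * e"
      unfolding G'_def using norm_family_diff[OF N(1) G mult_carrier_mat[OF P F]] e(2) PF by linarith
    have NH: "N H' \<le> e + e * N Q"
      unfolding H'_def using norm_family_diff[OF N(1) H mult_carrier_mat[OF F Q]] e(3) FQ by linarith
    have "N (U' * X * H') \<le> N H'"
    proof (rule norm_projection_mult[OF N(1,2) _ _ X3 H'])
      have "U' * X * (U' * X) = U' * X * U' * X"
        using dims by (simp add: mult_assoc_dim)
      then show "U' * X * (U' * X) = U' * X"
        unfolding X1 .
    qed (use U' Xc in simp)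
    then have UXH: "N (U' * X * H') \<le> e + e * N Q"
      using NH by linarith
    have XUQ: "N (X * U' * Q) \<le> N Q"
    proof (rule norm_projection_mult[OF N(1,2) _ _ X4 Q])
      have "X * U' * (X * U') = X * U' * X * U'"
        using dims by (simp add: mult_assoc_dim)
      then show "X * U' * (X * U') = X * U'"
        unfolding X2 .
    qed (use U' Xc in simp)
    have XH: "N (X * H') \<le> N X * (e + e * N Q)"
      by (rule mult[OF _ order_refl NH]) (simp add: dims)
    show ?thesis
      unfolding T_defs by (intro add_mono mult FQ UXH NG XUQ XH order_refl) (simp_all add: dims)
  qed
  also have "\<dots> = (N P + N Q + 3 * N P * N Q) * e + N X * (N P + N Q + N P * N Q + 1) * e\<^sup>2"
    by (simp add: power2_eq_square algebra_simps)
  finally show ?thesis .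
qed

theorem corollary4p3:
  fixes A E A' C R U C' R' U' W S V WI VJ :: "'a :: real_or_complex mat"
    and N :: "'a mat \<Rightarrow> real"
    and m n k :: nat and I J :: "nat set"
  assumes A: "A \<in> carrier_mat m n" and E: "E \<in> carrier_mat m n"
    and A': "A' = A + E"
    and k: "k = mat_rank A"
    and I: "I \<subseteq> {..<m}" and J: "J \<subseteq> {..<n}"
    and C: "C = submatrix A UNIV J" and R: "R = submatrix A I UNIV" and U: "U = submatrix A I J"
    and C': "C' = submatrix A' UNIV J" and R': "R' = submatrix A' I UNIV"
    and U': "U' = submatrix A' I J"
    and ranks: "mat_rank C = k" "mat_rank U = k" "mat_rank R = k"
    and svd: "compact_svd A W S V"
    and WI: "WI = submatrix W I UNIV" and VJ: "VJ = submatrix V J UNIV"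
    and N: "is_norm_family N" "normalized N" "uniformly_generated N"
      "unitarily_invariant N" "submultiplicative N"
  shows "N (A - C' * pinv U' * R')
      \<le> (N (pinv WI) + N (pinv VJ) + 3 * N (pinv WI) * N (pinv VJ)) * N E
        + N (pinv U') * (N (pinv WI) + N (pinv VJ) + N (pinv WI) * N (pinv VJ) + 1) * (N E)\<^sup>2"
proof -
  define r c where "r = card {i. i < m \<and> i \<in> I}" and "c = card {j. j < n \<and> j \<in> J}"
  define TI :: "'a mat" where "TI = selection_mat m I"
  define TJ :: "'a mat" where "TJ = selection_mat n J"
  have TI: "TI \<in> carrier_mat m r" and TJ: "TJ \<in> carrier_mat n c"
    by (simp_all add: TI_def TJ_def r_def c_def selection_mat_carrier)
  have orth: "orthonormal_cols TI" "orthonormal_cols TJ"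
    by (simp_all add: TI_def TJ_def orthonormal_cols_selection_mat)
  have "W \<in> carrier_mat m k \<and> orthonormal_cols W \<and> V \<in> carrier_mat n k \<and> orthonormal_cols V
      \<and> S = mat_diag k (\<lambda>i. of_real (singular_values A ! i)) \<and> A = W * S * mat_adjoint V"
    using svd unfolding compact_svd_def k carrier_matD[OF A] .
  then have W: "W \<in> carrier_mat m k" "orthonormal_cols W" and V: "V \<in> carrier_mat n k" "orthonormal_cols V"
    and S_eq: "S = mat_diag k (\<lambda>i. of_real (singular_values A ! i))" and A_eq: "A = W * S * mat_adjoint V"
    by blast+
  have S: "S \<in> carrier_mat k k"
    unfolding S_eq by simp
  have rows: "submatrix B I UNIV = mat_adjoint TI * B" if "B \<in> carrier_mat m q" for B q
    using adjoint_selection_mat_mult[OF that] by (simp add: TI_def)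
  have cols: "submatrix B UNIV J = B * TJ" if "B \<in> carrier_mat p n" for B p
    using mult_selection_mat[OF that] by (simp add: TJ_def)
  have both: "submatrix B I J = mat_adjoint TI * (B * TJ)" if "B \<in> carrier_mat m n" for B
    unfolding submatrix_split[of B I J] cols[OF that] using that TJ by (intro rows) auto
  have VJ_eq: "VJ = mat_adjoint TJ * V"
    unfolding VJ TJ_def using adjoint_selection_mat_mult[OF V(1)] by simp
  have WI_eq: "WI = mat_adjoint TI * W"
    unfolding WI by (rule rows[OF W(1)])
  have WIc: "WI \<in> carrier_mat r k" and VJc: "VJ \<in> carrier_mat c k"
    unfolding WI_eq VJ_eq using TI TJ W V by auto
  have A'c: "A' \<in> carrier_mat m n"
    unfolding A' using A E by simp
  define X where "X = pinv WI"
  define Z where "Z = pinv VJ"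
  have X: "X \<in> carrier_mat k r" and Z: "Z \<in> carrier_mat k c"
    unfolding X_def Z_def using WIc VJc by (auto intro: pinv_carrier)
  note dims = carrier_matD[OF A] carrier_matD[OF E] carrier_matD[OF TI] carrier_matD[OF TJ]
    carrier_matD[OF W(1)] carrier_matD[OF V(1)] carrier_matD[OF S] carrier_matD[OF WIc] carrier_matD[OF VJc]
    carrier_matD[OF X] carrier_matD[OF Z]
  have U_eq: "U = WI * S * mat_adjoint VJ"
    unfolding U both[OF A] unfolding A_eq WI_eq VJ_eq
    using dims by (simp add: mult_assoc_dim mat_adjoint_mult)
  have "U = WI * (S * mat_adjoint VJ)"
    unfolding U_eq using dims by (simp add: mult_assoc_dim)
  then have XWI: "X * WI = 1\<^sub>m k"
    unfolding X_def using ranks(2) S VJc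
    by (intro pinv_mult_full_column_rank[OF WIc, of "S * mat_adjoint VJ" c]) auto
  have ZVJ: "Z * VJ = 1\<^sub>m k"
    unfolding Z_def using ranks(2) S WIc unfolding U_eq
    by (intro pinv_mult_full_row_rank[OF _ VJc, of "WI * S" r]) auto
  \<comment> \<open>These are \<open>C * pinv U\<close> and \<open>pinv U * R\<close>, but in this form their norms can be read off.\<close>
  define P where "P = W * X"
  define Q where "Q = mat_adjoint (V * Z)"
  have P: "P \<in> carrier_mat m r" and Q: "Q \<in> carrier_mat c n"
    using W V X Z by (auto simp: P_def Q_def)
  have Q_eq: "Q = mat_adjoint Z * mat_adjoint V"
    unfolding Q_def using dims by (simp add: mat_adjoint_mult)
  have VZ: "mat_adjoint VJ * mat_adjoint Z = 1\<^sub>m k"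
  proof -
    have "mat_adjoint VJ * mat_adjoint Z = mat_adjoint (Z * VJ)"
      using dims by (simp add: mat_adjoint_mult)
    then show ?thesis
      unfolding ZVJ mat_adjoint_one .
  qed
  have Uc: "U \<in> carrier_mat r c"
    unfolding U_eq by (rule mult_carrier_mat[OF mult_carrier_mat[OF WIc S] mat_adjoint_carrier[OF VJc]])
  have "P * U = W * (X * WI) * S * mat_adjoint VJ"
    unfolding P_def U_eq using dims by (simp add: mult_assoc_dim)
  also have "\<dots> = A * TJ"
    unfolding XWI A_eq VJ_eq using dims by (simp add: mat_adjoint_mult mult_assoc_dim)
  finally have PU: "P * U = A * TJ" .
  have "U * Q = WI * S * (mat_adjoint VJ * mat_adjoint Z) * mat_adjoint V"
    unfolding Q_eq U_eq using dims by (simp add: mult_assoc_dim)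
  also have "\<dots> = mat_adjoint TI * A"
    unfolding VZ A_eq WI_eq using dims by (simp add: mult_assoc_dim)
  finally have UQ: "U * Q = mat_adjoint TI * A" .
  have "P * U * Q = W * (X * WI) * S * (mat_adjoint VJ * mat_adjoint Z) * mat_adjoint V"
    unfolding P_def Q_eq U_eq using dims by (simp add: mult_assoc_dim)
  also have "\<dots> = A"
    unfolding VZ XWI A_eq using dims by simp
  finally have PUQ: "P * U * Q = A" .
  have C'_eq: "C' = P * U + E * TJ"
    unfolding C' cols[OF A'c] unfolding A' PU by (rule add_mult_distrib_mat[OF A E TJ])
  have R'_eq: "R' = U * Q + mat_adjoint TI * E"
    unfolding R' rows[OF A'c] unfolding A' UQ by (rule mult_add_distrib_mat[OF mat_adjoint_carrier[OF TI] A E])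
  have "A' * TJ = A * TJ + E * TJ"
    unfolding A' by (rule add_mult_distrib_mat[OF A E TJ])
  then have U'_eq: "U' = U + mat_adjoint TI * (E * TJ)"
    unfolding U U' both[OF A] both[OF A'c]
    by (simp add: mult_add_distrib_mat[OF mat_adjoint_carrier[OF TI] mult_carrier_mat[OF A TJ] mult_carrier_mat[OF E TJ]])
  have NP: "N P = N (pinv WI)"
    unfolding P_def X_def[symmetric] using dims by (intro norm_isometry_mult[OF N(3) W(2)]) simp
  have NQ: "N Q = N (pinv VJ)"
    unfolding Q_def norm_adjoint[OF N(3)] Z_def[symmetric]
    using dims by (intro norm_isometry_mult[OF N(3) V(2)]) simp
  \<comment> \<open>The bound for deleting rows also applies to deleting columns, after passing to the adjoint.\<close>
  have "N (E * TJ) = N (mat_adjoint TJ * mat_adjoint E)"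
    using norm_adjoint[OF N(3), of "E * TJ"] dims by (simp add: mat_adjoint_mult)
  also have "\<dots> \<le> N (mat_adjoint E)"
    by (rule norm_coisometry_mult[OF N(1,3,4) TJ orth(2) mat_adjoint_carrier[OF E]])
  finally have NG: "N (E * TJ) \<le> N E"
    by (simp add: norm_adjoint[OF N(3)])
  have NF: "N (mat_adjoint TI * (E * TJ)) \<le> N E"
    using norm_coisometry_mult[OF N(1,3,4) TI orth(1) mult_carrier_mat[OF E TJ]] NG by linarith
  have NH: "N (mat_adjoint TI * E) \<le> N E"
    by (rule norm_coisometry_mult[OF N(1,3,4) TI orth(1) E])
  have "N (P * U * Q - (P * U + E * TJ) * pinv U' * (U * Q + mat_adjoint TI * E))
    \<le> (N P + N Q + 3 * N P * N Q) * N E + N (pinv U') * (N P + N Q + N P * N Q + 1) * (N E)\<^sup>2"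
    using TI TJ E
    by (intro cur_perturbation_bound[OF N(1,4,5) P Q Uc _ _ _ _ NF NG NH])
       (auto simp: U'_eq moore_penrose_pinv)
  then show ?thesis
    by (simp only: PUQ C'_eq R'_eq NP NQ)
qed

end
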